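(* Let $V$ be a finite set with a total order $\prec$ and let $\mathcal{K}$ be a simplicial complex with its vertices in $V$. Let $t,s\geq 0$ be integers and let $m\in \mathbb{Z}$. Suppose $m=\lambda(2t+1)+q$ where $\lambda\in \mathbb{Z}$ and $0\leq q\leq 2t$. Then: (i) for any $\alpha\in \mathrm{Ext}_{2t+1}(V)$, the graded vector space $$C_{(n+\lambda)(2t+1)+q}(\mathcal{K};\mathbb{R}),\qquad n\geq 0,$$ equipped with the boundary map $\alpha$ gives a sub-chain complex of $C_*(\Delta[V],\alpha,m)$, denoted $C_*(\mathcal{K},\alpha,m)$; (ii) for any $\alpha\in \mathrm{Ext}_{2t+1}(V)$ and any $\beta\in \mathrm{Ext}_{2s}(V)$, there is an induced chain map $$\beta:\ C_*(\mathcal{K},\alpha,m)\longrightarrow C_*(\mathcal{K},\alpha,m-2s).$$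
   Context: For $n\ge 0$, $\Lambda_n(V)$ is the real vector space with basis the elementary $n$-paths on $V$, i.e. all ordered sequences $v_0v_1\ldots v_n$ of $n+1$ vertices of $V$ (repetitions allowed, no order condition); $\Lambda_k(V)=0$ for $k<0$. Let $\delta(u,v)=1$ if $u=v$ and $0$ otherwise. For $v\in V$, the linear map $\frac{\partial}{\partial v}:\Lambda_n(V)\to\Lambda_{n-1}(V)$ ($n\ge0$) is given by $$\frac{\partial}{\partial v}(v_0v_1\ldots v_n)=\sum_{i=0}^n(-1)^i\delta(v,v_i)\,v_0\ldots\widehat{v_i}\ldots v_n.$$ One has $\frac{\partial}{\partial u}\circ\frac{\partial}{\partial v}=-\frac{\partial}{\partial v}\circ\frac{\partial}{\partial u}$. $\mathrm{Ext}_*(V)=\bigoplus_{k\ge0}\mathrm{Ext}_k(V)$ is the real exterior algebra generated by the $\frac{\partial}{\partial v}$, $v\in V$ ($\mathrm{Ext}_0(V)=\mathbb{R}$ acts by scalars), with product $\wedge$ the composition of linear maps, so an element of $\mathrm{Ext}_k(V)$ acts as linear maps $\Lambda_n(V)\to\Lambda_{n-k}(V)$. An $n$-hyperedge on $V$ is a sequence $v_0v_1\ldots v_n$ of vertices with $v_0\prec v_1\prec\cdots\prec v_n$, identified with the set $\{v_0,\ldots,v_n\}$; the complete hypergraph $\Delta[V]$ is the set of all hyperedges on $V$. A simplicial complex $\mathcal{K}$ with vertices in $V$ is a set of hyperedges on $V$ such that every non-empty subset of an element of $\mathcal{K}$ is in $\mathcal{K}$; the $n$-hyperedges in $\mathcal{K}$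 are its $n$-simplices. $C_n(\mathcal{K};\mathbb{R})$ (resp. $C_n(\Delta[V];\mathbb{R})$) is the real vector space of linear combinations of $n$-simplices of $\mathcal{K}$ (resp. of all $n$-hyperedges on $V$), a subspace of $\Lambda_n(V)$; it is $0$ for $n<0$. Elements of $\mathrm{Ext}_*(V)$ act by restriction. Given $t\ge0$, each integer $m$ is written uniquely as $m=\lambda(2t+1)+q$ with $\lambda\in\mathbb{Z}$, $0\le q\le 2t$. For $\alpha\in\mathrm{Ext}_{2t+1}(V)$, $C_*(\Delta[V],\alpha,m)$ is the chain complex with degree-$n$ term $C_{(n+\lambda)(2t+1)+q}(\Delta[V];\mathbb{R})$, $n\ge0$, and boundary map $\alpha$ (zero out of degree $n=0$). *)

theory Defs
  imports "HOL-Analysis.Finite_Function_Topology"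
begin

text \<open>
  A path v0 v1 ... vn is a list of length n + 1, and formal real linear combinations of paths
  are finitely supported functions on lists.  All the spaces of n-paths thus sit inside one real
  vector space.  This type also contains the empty list as a basis element; it belongs to no
  space of n-paths, as these vanish for n < 0, and all maps below are arranged so that it is
  never produced.
\<close>

type_synonym 'v paths = "'v list \<Rightarrow>\<^sub>0 real"

definition delete_nth :: "nat \<Rightarrow> 'v list \<Rightarrow> 'v list"
  where "delete_nth i p = take i p @ drop (Suc i) p"

text \<open>
  The partial derivative of a single path.  It is zero on paths of length at most one, because
  the 0-paths v0 are mapped to the zero space in degree -1.
\<close>

definition pd_path :: "'v \<Rightarrow> 'v list \<Rightarrow> 'v paths"
  where "pd_path v p =
    (if length p \<le> 1 then 0
     else (\<Sum>i<length p. Poly_Mapping.single (delete_nth i p)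
                          ((- 1) ^ i * (if v = p ! i then 1 else 0))))"

definition pd :: "'v \<Rightarrow> 'v paths \<Rightarrow> 'v paths"
  where "pd v x = (\<Sum>p\<in>Poly_Mapping.keys x. Poly_Mapping.lookup x p *\<^sub>R pd_path v p)"

text \<open>
  The wedge product of partial derivatives is their composition; the empty product is the
  identity.  The elements of degree k in the exterior algebra are the real linear combinations
  of k-fold products, realized as operators, so that degree 0 consists of the scalars.
  Monomials with repeated factors are allowed but vanish, since the partial derivatives
  anticommute.
\<close>

definition pd_wedge :: "'v list \<Rightarrow> 'v paths \<Rightarrow> 'v paths"
  where "pd_wedge vs = foldr (\<circ>) (map pd vs) id"

definition Ext :: "'v set \<Rightarrow> nat \<Rightarrow> ('v paths \<Rightarrow> 'v paths) set"
  where "Ext V k =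
    {\<alpha>. \<exists>c :: 'v list \<Rightarrow> real.
       \<alpha> = (\<lambda>x. \<Sum>vs\<in>{vs. set vs \<subseteq> V \<and> length vs = k}. c vs *\<^sub>R pd_wedge vs x)}"

text \<open>
  Hyperedges are kept as strictly increasing sequences; such a sequence is determined by its
  set of entries.
\<close>

definition complete_hypergraph :: "'v::linorder set \<Rightarrow> 'v list set"
  where "complete_hypergraph V = {\<sigma>. \<sigma> \<noteq> [] \<and> sorted_wrt (<) \<sigma> \<and> set \<sigma> \<subseteq> V}"

definition simplicial_complex :: "'v::linorder set \<Rightarrow> 'v list set \<Rightarrow> bool"
  where "simplicial_complex V K \<longleftrightarrow>
    K \<subseteq> complete_hypergraph V \<and>
    (\<forall>\<sigma>\<in>K. \<forall>\<tau>\<in>complete_hypergraph V. set \<tau> \<subseteq> set \<sigma> \<longrightarrow> \<tau> \<in> K)"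

text \<open>The degree is an integer; for a set of non-empty lists this is the zero space when n < 0.\<close>

definition chains :: "'v list set \<Rightarrow> int \<Rightarrow> 'v paths set"
  where "chains K n = span {Poly_Mapping.single \<sigma> 1 | \<sigma>. \<sigma> \<in> K \<and> int (length \<sigma>) = n + 1}"

text \<open>
  Chain complexes of real vector spaces in degrees n \<ge> 0, all of whose terms are subspaces of
  one ambient space.  The field bdry at n is the boundary map out of degree n, and only its
  values on the degree n term are relevant.
\<close>

record 'a cpx =
  grp :: "nat \<Rightarrow> 'a set"
  bdry :: "nat \<Rightarrow> 'a \<Rightarrow> 'a"

definition linear_map_between ::
    "'a::real_vector set \<Rightarrow> 'b::real_vector set \<Rightarrow> ('a \<Rightarrow> 'b) \<Rightarrow> bool"
  where "linear_map_between A B f \<longleftrightarrow>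
    f ` A \<subseteq> B \<and>
    (\<forall>x\<in>A. \<forall>y\<in>A. f (x + y) = f x + f y) \<and>
    (\<forall>r. \<forall>x\<in>A. f (r *\<^sub>R x) = r *\<^sub>R f x)"

definition chain_complex :: "'a::real_vector cpx \<Rightarrow> bool"
  where "chain_complex C \<longleftrightarrow>
    (\<forall>n. subspace (grp C n)) \<and>
    (\<forall>x\<in>grp C 0. bdry C 0 x = 0) \<and>
    (\<forall>n. linear_map_between (grp C (Suc n)) (grp C n) (bdry C (Suc n))) \<and>
    (\<forall>n. \<forall>x\<in>grp C (Suc n). bdry C n (bdry C (Suc n) x) = 0)"

definition sub_chain_complex :: "'a::real_vector cpx \<Rightarrow> 'a cpx \<Rightarrow> bool"
  where "sub_chain_complex C D \<longleftrightarrow>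
    chain_complex C \<and> chain_complex D \<and>
    (\<forall>n. grp C n \<subseteq> grp D n) \<and>
    (\<forall>n. \<forall>x\<in>grp C n. bdry C n x = bdry D n x)"

definition chain_map ::
    "'a::real_vector cpx \<Rightarrow> 'b::real_vector cpx \<Rightarrow> (nat \<Rightarrow> 'a \<Rightarrow> 'b) \<Rightarrow> bool"
  where "chain_map C D f \<longleftrightarrow>
    chain_complex C \<and> chain_complex D \<and>
    (\<forall>n. linear_map_between (grp C n) (grp D n) (f n)) \<and>
    (\<forall>n. \<forall>x\<in>grp C (Suc n). bdry D (Suc n) (f (Suc n) x) = f n (bdry C (Suc n) x))"

definition shifted_chains ::
    "'v list set \<Rightarrow> nat \<Rightarrow> int \<Rightarrow> int \<Rightarrow> ('v paths \<Rightarrow> 'v paths) \<Rightarrow> 'v paths cpx"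
  where "shifted_chains K t l q \<alpha> =
    \<lparr> grp = (\<lambda>n. chains K ((int n + l) * (2 * int t + 1) + q)),
      bdry = (\<lambda>n x. if n = 0 then 0 else \<alpha> x) \<rparr>"

text \<open>
  In the unique decomposition m = l * (2 * t + 1) + q with 0 \<le> q \<le> 2 * t, the numbers l and q
  are the quotient and the remainder of m.
\<close>

definition ext_complex ::
    "'v list set \<Rightarrow> nat \<Rightarrow> ('v paths \<Rightarrow> 'v paths) \<Rightarrow> int \<Rightarrow> 'v paths cpx"
  where "ext_complex K t \<alpha> m =
    shifted_chains K t (m div (2 * int t + 1)) (m mod (2 * int t + 1)) \<alpha>"

end

theory Submission
  imports Defs
begin

text \<open>
  Everything reduces to the single operators \<open>pd v\<close>.  They lower the degree by one and preserve
  simplicial complexes, because each term deletes one vertex from a simplex.  If \<open>C\<close> prefixes a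
  vertex \<open>a\<close> to paths and \<open>D v\<close> is \<open>pd v\<close> without the truncation in degree 0, then
  \<open>D v (C x) = (if v = a then x else 0) - C (D v x)\<close>, and anticommutativity follows by induction
  on the path.  Hence elements of exterior degrees \<open>j\<close> and \<open>k\<close> commute up to the sign
  \<open>(-1)^(j * k)\<close>: an element of odd degree squares to zero, and an element of even degree is a
  chain map.
\<close>

section \<open>Linear extension of maps given on basis elements\<close>

definition linear_extension :: "('a \<Rightarrow> 'b::real_vector) \<Rightarrow> ('a \<Rightarrow>\<^sub>0 real) \<Rightarrow> 'b"
  where "linear_extension f x =
    (\<Sum>p\<in>Poly_Mapping.keys x. Poly_Mapping.lookup x p *\<^sub>R f p)"

lemma lookup_scaleR_poly_mapping:
  fixes x :: "'a \<Rightarrow>\<^sub>0 'b::real_vector"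
  shows "Poly_Mapping.lookup (r *\<^sub>R x) p = r *\<^sub>R Poly_Mapping.lookup x p"
proof -
  have "finite {i. r *\<^sub>R Poly_Mapping.lookup x i \<noteq> 0}"
    by (rule finite_subset[OF _ finite_lookup[of x]]) auto
  then show ?thesis
    by (simp add: scaleR_poly_mapping_def Abs_poly_mapping_inverse)
qed

lemma scaleR_single:
  "r *\<^sub>R Poly_Mapping.single p (c::real) = Poly_Mapping.single p (r * c)"
  by (rule poly_mapping_eqI) (simp add: lookup_scaleR_poly_mapping lookup_single when_def)

text \<open>Cancellation can make the support of a sum smaller than the union of the supports.
  Summing over a larger finite set lets several vectors share one index set.\<close>

lemma linear_extension_superset:
  assumes "finite A" "Poly_Mapping.keys x \<subseteq> A"
  shows "linear_extension f x = (\<Sum>p\<in>A. Poly_Mapping.lookup x p *\<^sub>R f p)"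
  unfolding linear_extension_def
  by (rule sum.mono_neutral_left) (use assms in \<open>auto simp: in_keys_iff\<close>)

lemma linear_linear_extension: "linear (linear_extension f)"
proof (rule linearI)
  fix x y :: "'a \<Rightarrow>\<^sub>0 real"
  let ?A = "Poly_Mapping.keys x \<union> Poly_Mapping.keys y"
  have "linear_extension f (x + y) = (\<Sum>p\<in>?A. Poly_Mapping.lookup (x + y) p *\<^sub>R f p)"
    by (rule linear_extension_superset) (use Poly_Mapping.keys_add[of x y] in auto)
  also have "\<dots> = (\<Sum>p\<in>?A. Poly_Mapping.lookup x p *\<^sub>R f p)
                  + (\<Sum>p\<in>?A. Poly_Mapping.lookup y p *\<^sub>R f p)"
    by (simp add: lookup_add scaleR_left_distrib sum.distrib)
  also have "\<dots> = linear_extension f x + linear_extension f y"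
    by (simp add: linear_extension_superset[of ?A])
  finally show "linear_extension f (x + y) = linear_extension f x + linear_extension f y" .
next
  fix r and x :: "'a \<Rightarrow>\<^sub>0 real"
  have "linear_extension f (r *\<^sub>R x)
      = (\<Sum>p\<in>Poly_Mapping.keys x. Poly_Mapping.lookup (r *\<^sub>R x) p *\<^sub>R f p)"
    by (rule linear_extension_superset) (auto simp: in_keys_iff lookup_scaleR_poly_mapping)
  then show "linear_extension f (r *\<^sub>R x) = r *\<^sub>R linear_extension f x"
    by (simp add: lookup_scaleR_poly_mapping scaleR_sum_right linear_extension_def)
qed

lemma linear_extension_single [simp]:
  "linear_extension f (Poly_Mapping.single p c) = c *\<^sub>R f p"
  by (simp add: linear_extension_superset[of "{p}"])

lemma poly_mapping_in_span_singles:
  "x \<in> span (range (\<lambda>p. Poly_Mapping.single p (1::real)))"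
proof (induction x rule: Poly_Mapping.update_induct)
  case const
  show ?case by (rule span_zero)
next
  case (update f a b)
  \<comment> \<open>Since \<open>a\<close> is not a key of \<open>f\<close>, the update overwrites
    only the value 0 and so is an addition.\<close>
  have "Poly_Mapping.update a b f = f + b *\<^sub>R Poly_Mapping.single a 1"
    using update(1)
    by (intro poly_mapping_eqI)
      (auto simp: lookup_add lookup_update lookup_scaleR_poly_mapping lookup_single when_def in_keys_iff)
  then show ?case
    using update(3) by (simp add: span_add span_scale span_base)
qed

lemma linear_eq_on_singles:
  fixes f g :: "('a \<Rightarrow>\<^sub>0 real) \<Rightarrow> 'b::real_vector"
  assumes "linear f" "linear g"
    and "\<And>p. f (Poly_Mapping.single p 1) = g (Poly_Mapping.single p 1)"
  shows "f x = g x"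
  by (rule linear_eq_on[OF assms(1,2) poly_mapping_in_span_singles]) (use assms(3) in auto)

section \<open>Partial derivatives and their anticommutativity\<close>

lemma pd_eq_linear_extension: "pd v = linear_extension (pd_path v)"
  by (simp add: fun_eq_iff pd_def linear_extension_def)

lemma linear_pd: "linear (pd v)"
  by (simp add: pd_eq_linear_extension linear_linear_extension)

lemma pd_single [simp]: "pd v (Poly_Mapping.single p c) = c *\<^sub>R pd_path v p"
  by (simp add: pd_eq_linear_extension)

definition cons_path :: "'v \<Rightarrow> 'v paths \<Rightarrow> 'v paths"
  where "cons_path a = linear_extension (\<lambda>p. Poly_Mapping.single (a # p) 1)"

lemma linear_cons_path: "linear (cons_path a)"
  by (simp add: cons_path_def linear_linear_extension)

lemma cons_path_single [simp]:
  "cons_path a (Poly_Mapping.single p c) = Poly_Mapping.single (a # p) c"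
  by (simp add: cons_path_def scaleR_single)


text \<open>
  Unlike \<open>pd_path v\<close>, this sends \<open>[v]\<close> to the empty list: only without the truncation does the
  recursion hold for all paths.
\<close>

primrec deletion_path :: "'v \<Rightarrow> 'v list \<Rightarrow> 'v paths"
  where
    "deletion_path v [] = 0"
  | "deletion_path v (a # p) =
      Poly_Mapping.single p (if v = a then 1 else 0) - cons_path a (deletion_path v p)"

definition deletion :: "'v \<Rightarrow> 'v paths \<Rightarrow> 'v paths"
  where "deletion v = linear_extension (deletion_path v)"

lemma linear_deletion: "linear (deletion v)"
  by (simp add: deletion_def linear_linear_extension)

lemma deletion_single [simp]: "deletion v (Poly_Mapping.single p c) = c *\<^sub>R deletion_path v p"
  by (simp add: deletion_def)

text \<open>The summand for index 0 deletes the head. All others keep it, and their index shift by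
  one yields the minus sign in front of \<open>cons_path\<close>.\<close>

lemma deletion_path_eq_sum:
  "deletion_path v p =
    (\<Sum>i<length p. Poly_Mapping.single (delete_nth i p) ((- 1) ^ i * (if v = p ! i then 1 else 0)))"
proof (induction p)
  case Nil
  show ?case by simp
next
  case (Cons a p)
  then show ?case
    by (simp add: sum.lessThan_Suc_shift delete_nth_def linear_sum[OF linear_cons_path]
        single_uminus sum_negf del: sum.lessThan_Suc)
qed

text \<open>Truncation matters only at length 1, where \<open>deletion_path\<close> can produce the
  empty list; on the empty list itself both sides are zero.\<close>

lemma pd_path_eq_deletion_path: "length p \<noteq> 1 \<Longrightarrow> pd_path v p = deletion_path v p"
  by (cases p) (auto simp: pd_path_def deletion_path_eq_sum)

lemma pd_path_short: "length p \<le> 1 \<Longrightarrow> pd_path v p = 0"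
  by (simp add: pd_path_def)

lemma length_delete_nth: "i < length p \<Longrightarrow> length (delete_nth i p) = length p - 1"
  by (simp add: delete_nth_def)

text \<open>On a basis path this is the defining recursion of \<open>deletion_path\<close>, and both
  sides are linear in \<open>x\<close>.\<close>

lemma deletion_cons_path:
  "deletion u (cons_path a x) = (if u = a then x else 0) - cons_path a (deletion u x)"
proof (rule linear_eq_on_singles[where f = "\<lambda>x. deletion u (cons_path a x)"])
  show "linear (\<lambda>x. deletion u (cons_path a x))"
    by (rule linear_compose[unfolded o_def, OF linear_cons_path linear_deletion])
  show "linear (\<lambda>x. (if u = a then x else 0) - cons_path a (deletion u x))"
    by (intro linear_compose_sub linear_compose[unfolded o_def, OF linear_deletion linear_cons_path])
      (simp add: linear_iff)
qed simp

lemma deletion_path_anticommute: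
  "deletion u (deletion_path v p) = - deletion v (deletion_path u p)"
proof (induction p)
  case Nil
  show ?case by (simp add: linear_0[OF linear_deletion])
next
  case (Cons a p)
  \<comment> \<open>Exchanging \<open>u\<close> and \<open>v\<close> negates the difference of the
    first two terms; the induction hypothesis does the same for the last one.\<close>
  have *: "deletion u (deletion_path v (a # p)) =
      (if v = a then deletion_path u p else 0) - (if u = a then deletion_path v p else 0)
        + cons_path a (deletion u (deletion_path v p))" for u v
    by (simp add: linear_diff[OF linear_deletion] deletion_cons_path)
  show ?case
    unfolding * by (subst Cons.IH) (simp add: linear_neg[OF linear_cons_path])
qed

text \<open>From length 3 on, two deletions never reach the empty list, so truncation is invisible;
  on shorter paths it makes the composite zero. The case split depends on neither \<open>u\<close>
  nor \<open>v\<close>, so antisymmetry passes from \<open>deletion\<close> to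
  \<open>pd\<close>.\<close>

lemma pd_pd_path:
  "pd u (pd_path v p) = (if length p \<le> 2 then 0 else deletion u (deletion_path v p))"
proof -
  let ?c = "\<lambda>i. (- 1) ^ i * (if v = p ! i then 1 else 0) :: real"
  have "pd u (deletion_path v p) =
      (\<Sum>i<length p. ?c i *\<^sub>R pd_path u (delete_nth i p))"
    by (simp add: deletion_path_eq_sum linear_sum[OF linear_pd])
  moreover have "deletion u (deletion_path v p) =
      (\<Sum>i<length p. ?c i *\<^sub>R deletion_path u (delete_nth i p))"
    by (simp add: deletion_path_eq_sum[of v] linear_sum[OF linear_deletion])
  moreover have "pd_path u (delete_nth i p) =
      (if length p \<le> 2 then 0 else deletion_path u (delete_nth i p))" if "i < length p" for i
    using that by (simp add: length_delete_nth pd_path_short pd_path_eq_deletion_path)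
  ultimately show ?thesis
    by (cases "length p \<le> 1")
      (simp_all add: pd_path_short pd_path_eq_deletion_path linear_0[OF linear_pd])
qed

lemma pd_anticommute: "pd u (pd v x) = - pd v (pd u x)"
proof (rule linear_eq_on_singles[where f = "\<lambda>x. pd u (pd v x)"])
  have *: "linear (\<lambda>x. pd u (pd v x))" for u v :: 'a
    by (rule linear_compose[unfolded o_def, OF linear_pd linear_pd])
  show "linear (\<lambda>x. pd u (pd v x))" by (rule *)
  show "linear (\<lambda>x. - pd v (pd u x))" by (intro linear_compose_neg *)
qed (simp add: pd_pd_path deletion_path_anticommute[of u])

section \<open>The sign rule in the exterior algebra\<close>

lemma pd_wedge_Nil [simp]: "pd_wedge [] x = x"
  by (simp add: pd_wedge_def)

lemma pd_wedge_Cons [simp]: "pd_wedge (v # vs) x = pd v (pd_wedge vs x)"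
  by (simp add: pd_wedge_def)

lemma linear_pd_wedge: "linear (pd_wedge vs)"
proof (induction vs)
  case Nil
  show ?case by (simp add: linear_iff)
next
  case (Cons v vs)
  then show ?case
    using linear_compose[OF Cons.IH linear_pd, of v] by (simp add: o_def)
qed

lemma pd_pd_wedge_commute:
  "pd u (pd_wedge vs x) = (- 1) ^ length vs *\<^sub>R pd_wedge vs (pd u x)"
proof (induction vs)
  case (Cons v vs)
  then show ?case
    \<comment> \<open>With \<open>u\<close> fixed, rewriting only pushes \<open>pd u\<close>
      inwards, at the cost of one sign per factor.\<close>
    by (simp add: pd_anticommute[of u] linear_scale[OF linear_pd])
qed simp

lemma pd_wedge_commute:
  "pd_wedge us (pd_wedge vs x) =
    (- 1) ^ (length us * length vs) *\<^sub>R pd_wedge vs (pd_wedge us x)"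
  by (induction us)
    (simp_all add: pd_pd_wedge_commute linear_scale[OF linear_pd] power_add mult.commute)

lemma Ext_linear:
  assumes "\<alpha> \<in> Ext V k"
  shows "linear \<alpha>"
proof -
  obtain c where "\<alpha> = (\<lambda>x. \<Sum>vs\<in>{vs. set vs \<subseteq> V \<and> length vs = k}. c vs *\<^sub>R pd_wedge vs x)"
    using assms by (auto simp: Ext_def)
  then show ?thesis
    by (auto intro!: linear_compose_sum linear_compose_scale_right linear_pd_wedge)
qed

text \<open>The sign rule is made bilinear one factor at a time: here \<open>\<alpha>\<close> is
  expanded against a monomial, and \<open>Ext_commute\<close> then expands the other factor.\<close>

lemma Ext_pd_wedge_commute:
  assumes "\<alpha> \<in> Ext V k"
  shows "pd_wedge us (\<alpha> x) = (- 1) ^ (length us * k) *\<^sub>R \<alpha> (pd_wedge us x)"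
proof -
  obtain c where "\<alpha> = (\<lambda>x. \<Sum>vs\<in>{vs. set vs \<subseteq> V \<and> length vs = k}. c vs *\<^sub>R pd_wedge vs x)"
    using assms by (auto simp: Ext_def)
  then show ?thesis
    by (simp add: linear_sum[OF linear_pd_wedge] linear_scale[OF linear_pd_wedge]
        pd_wedge_commute[of us] scaleR_sum_right mult.commute)
qed

lemma Ext_commute:
  assumes "\<alpha> \<in> Ext V j" "\<beta> \<in> Ext V k"
  shows "\<alpha> (\<beta> x) = (- 1) ^ (j * k) *\<^sub>R \<beta> (\<alpha> x)"
proof -
  obtain c where "\<alpha> = (\<lambda>x. \<Sum>us\<in>{us. set us \<subseteq> V \<and> length us = j}. c us *\<^sub>R pd_wedge us x)"
    using assms(1) by (auto simp: Ext_def)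
  then show ?thesis
    by (simp add: linear_sum[OF Ext_linear[OF assms(2)]] linear_scale[OF Ext_linear[OF assms(2)]]
        Ext_pd_wedge_commute[OF assms(2)] scaleR_sum_right mult.commute)
qed

lemma Ext_odd_square_zero:
  assumes "\<alpha> \<in> Ext V k" "odd k"
  shows "\<alpha> (\<alpha> x) = 0"
proof -
  \<comment> \<open>Commuting \<open>\<alpha>\<close> past itself has the sign exponent
    \<open>k * k\<close>, which is odd.\<close>
  have "\<alpha> (\<alpha> x) = - \<alpha> (\<alpha> x)"
    using Ext_commute[OF assms(1,1), of x] assms(2) by simp
  then show ?thesis by (simp add: eq_neg_iff_add_eq_0 flip: scaleR_2)
qed

section \<open>Faces of simplices and spaces of chains\<close>

lemma simplicial_complex_complete_hypergraph: "simplicial_complex V (complete_hypergraph V)"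
  by (simp add: simplicial_complex_def)

text \<open>The result is a face: deletion keeps the order strict, and the length bound keeps the
  sequence non-empty, as hyperedges must be.\<close>

lemma simplicial_complex_delete_nth:
  assumes "simplicial_complex V K" "\<sigma> \<in> K" "i < length \<sigma>" "2 \<le> length \<sigma>"
  shows "delete_nth i \<sigma> \<in> K"
proof -
  have \<sigma>: "sorted_wrt (<) \<sigma>" "set \<sigma> \<subseteq> V"
    using assms(1,2) by (auto simp: simplicial_complex_def complete_hypergraph_def)
  have sub: "set (delete_nth i \<sigma>) \<subseteq> set \<sigma>"
    by (auto simp: delete_nth_def dest: in_set_takeD in_set_dropD)
  have "sorted_wrt (<) (take i \<sigma> @ drop i \<sigma>)"
    using \<sigma>(1) by simp
  then have "sorted_wrt (<) (delete_nth i \<sigma>)"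
    using assms(3) by (simp add: delete_nth_def sorted_wrt_append flip: Cons_nth_drop_Suc)
  moreover have "delete_nth i \<sigma> \<noteq> []"
    using length_delete_nth[OF assms(3)] assms(4) by force
  ultimately have "delete_nth i \<sigma> \<in> complete_hypergraph V"
    using sub \<sigma>(2) by (simp add: complete_hypergraph_def)
  then show ?thesis
    using assms(1,2) sub by (auto simp: simplicial_complex_def)
qed

lemma single_in_chains:
  assumes "\<sigma> \<in> K" "int (length \<sigma>) = n + 1"
  shows "Poly_Mapping.single \<sigma> c \<in> chains K n"
proof -
  have "c *\<^sub>R Poly_Mapping.single \<sigma> 1 \<in> chains K n"
    unfolding chains_def using assms by (intro span_scale span_base) auto
  then show ?thesis by (simp add: scaleR_single)
qed

lemma subspace_chains: "subspace (chains K n)"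
  by (simp add: chains_def)

lemma chains_mono: "K \<subseteq> L \<Longrightarrow> chains K n \<subseteq> chains L n"
  unfolding chains_def by (intro span_mono) auto

text \<open>By linearity it is enough to treat a single simplex, where each summand is a multiple of
  a face. A vertex goes to zero by truncation, as degree -1 requires.\<close>

lemma pd_chains:
  assumes "simplicial_complex V K" "x \<in> chains K n"
  shows "pd v x \<in> chains K (n - 1)"
  using assms(2) unfolding chains_def[of K n]
proof (induction x rule: span_induct_alt)
  case base
  show ?case by (simp add: linear_0[OF linear_pd] subspace_0[OF subspace_chains])
next
  case (step c x y)
  then obtain \<sigma> where \<sigma>: "x = Poly_Mapping.single \<sigma> 1" "\<sigma> \<in> K" "int (length \<sigma>) = n + 1"
    by auto
  have "pd_path v \<sigma> \<in> chains K (n - 1)"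
  proof (cases "length \<sigma> \<le> 1")
    case True
    then show ?thesis by (simp add: pd_path_short subspace_0[OF subspace_chains])
  next
    case False
    then show ?thesis
      using \<sigma>(2,3) unfolding pd_path_def
      by (auto intro!: subspace_sum[OF subspace_chains] single_in_chains
          simplicial_complex_delete_nth[OF assms(1)] simp: length_delete_nth)
  qed
  with step(2) \<sigma>(1) show ?case
    by (simp add: linear_add[OF linear_pd] linear_scale[OF linear_pd]
        subspace_add[OF subspace_chains] subspace_scale[OF subspace_chains])
qed

lemma pd_wedge_chains:
  assumes "simplicial_complex V K" "x \<in> chains K n"
  shows "pd_wedge vs x \<in> chains K (n - int (length vs))"
proof (induction vs)
  case (Cons v vs)
  then show ?case
    using pd_chains[OF assms(1) Cons, of v] by (simp add: algebra_simps)
qed (use assms(2) in simp)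

lemma Ext_chains:
  assumes "simplicial_complex W K" "\<alpha> \<in> Ext V k" "x \<in> chains K n"
  shows "\<alpha> x \<in> chains K (n - int k)"
proof -
  obtain c where "\<alpha> = (\<lambda>x. \<Sum>vs\<in>{vs. set vs \<subseteq> V \<and> length vs = k}. c vs *\<^sub>R pd_wedge vs x)"
    using assms(2) by (auto simp: Ext_def)
  then show ?thesis
    using pd_wedge_chains[OF assms(1,3)]
    by (auto intro!: subspace_sum[OF subspace_chains] subspace_scale[OF subspace_chains])
qed

text \<open>The target degree is a separate variable, so that the rule applies to degrees in any
  form and leaves the index arithmetic as a side condition.\<close>

lemma Ext_linear_map_between:
  assumes "simplicial_complex W K" "\<alpha> \<in> Ext V k" "n' = n - int k"
  shows "linear_map_between (chains K n) (chains K n') \<alpha>"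
  using Ext_chains[OF assms(1,2)] Ext_linear[OF assms(2)] assms(3)
  by (auto simp: linear_map_between_def linear_add linear_scale)

section \<open>Chain complexes and chain maps\<close>

lemma chain_complex_shifted_chains:
  assumes "simplicial_complex W K" "\<alpha> \<in> Ext V (2 * t + 1)"
  shows "chain_complex (shifted_chains K t l q \<alpha>)"
  unfolding chain_complex_def shifted_chains_def
  using Ext_odd_square_zero[OF assms(2)]
  \<comment> \<open>Consecutive terms differ in degree by exactly \<open>2 * t + 1\<close>, the
    exterior degree of \<open>\<alpha>\<close>.\<close>
  by (auto simp: subspace_chains algebra_simps intro!: Ext_linear_map_between[OF assms])

lemma chain_map_Ext:
  assumes "simplicial_complex W K" "\<alpha> \<in> Ext V (2 * t + 1)" "\<beta> \<in> Ext V (2 * s)"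
  shows "chain_map (ext_complex K t \<alpha> m) (ext_complex K t \<alpha> (m - 2 * int s)) (\<lambda>n. \<beta>)"
proof -
  let ?d = "2 * int t + 1"
  \<comment> \<open>Quotient and remainder recombine to \<open>k\<close>. Hence passing from
    \<open>m\<close> to \<open>m - 2 * int s\<close> lowers the degree of every term by exactly
    \<open>2 * s\<close>, even where the quotient changes.\<close>
  have grp: "grp (ext_complex K t \<alpha> k) n = chains K (int n * ?d + k)" for k n
  proof -
    have "(int n + k div ?d) * ?d + k mod ?d = int n * ?d + k"
      by (simp only: distrib_right add.assoc div_mult_mod_eq)
    then show ?thesis by (simp add: ext_complex_def shifted_chains_def)
  qed
  have bdry: "bdry (ext_complex K t \<alpha> k) (Suc n) x = \<alpha> x" for k n x
    by (simp add: ext_complex_def shifted_chains_def)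
  have "linear_map_between (grp (ext_complex K t \<alpha> m) n)
      (grp (ext_complex K t \<alpha> (m - 2 * int s)) n) \<beta>" for n
    unfolding grp by (rule Ext_linear_map_between[OF assms(1,3)]) simp
  \<comment> \<open>The sign exponent \<open>(2 * t + 1) * (2 * s)\<close> is even, so
    \<open>\<alpha>\<close> and \<open>\<beta>\<close> commute.\<close>
  moreover have "bdry (ext_complex K t \<alpha> (m - 2 * int s)) (Suc n) (\<beta> x) =
      \<beta> (bdry (ext_complex K t \<alpha> m) (Suc n) x)" for n x
    unfolding bdry using Ext_commute[OF assms(2,3), of x] by simp
  moreover have "chain_complex (ext_complex K t \<alpha> k)" for k
    unfolding ext_complex_def by (rule chain_complex_shifted_chains[OF assms(1,2)])
  ultimately show ?thesis
    by (simp add: chain_map_def)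
qed

theorem theorem4p5:
  fixes V :: "'v::linorder set" and K :: "'v list set"
    and t s :: nat and m l q :: int
  assumes "finite V"
    and "simplicial_complex V K"
    and "m = l * (2 * int t + 1) + q" and "0 \<le> q" and "q \<le> 2 * int t"
  shows "(\<forall>\<alpha>\<in>Ext V (2 * t + 1).
            sub_chain_complex (shifted_chains K t l q \<alpha>)
              (ext_complex (complete_hypergraph V) t \<alpha> m) \<and>
            shifted_chains K t l q \<alpha> = ext_complex K t \<alpha> m) \<and>
         (\<forall>\<alpha>\<in>Ext V (2 * t + 1). \<forall>\<beta>\<in>Ext V (2 * s).
            chain_map (ext_complex K t \<alpha> m) (ext_complex K t \<alpha> (m - 2 * int s)) (\<lambda>n. \<beta>))"
proof -
  have "m div (2 * int t + 1) = l" "m mod (2 * int t + 1) = q"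
    using assms(3-5) by (auto simp: div_add1_eq)
  \<comment> \<open>Stated for every \<open>L\<close>, since it serves both \<open>K\<close> and the
    complete hypergraph.\<close>
  then have ext: "ext_complex L t \<alpha> m = shifted_chains L t l q \<alpha>" for L :: "'v list set" and \<alpha>
    by (simp add: ext_complex_def)
  have "K \<subseteq> complete_hypergraph V"
    using assms(2) by (simp add: simplicial_complex_def)
  then have "sub_chain_complex (shifted_chains K t l q \<alpha>)
      (shifted_chains (complete_hypergraph V) t l q \<alpha>)" if "\<alpha> \<in> Ext V (2 * t + 1)" for \<alpha>
    using chain_complex_shifted_chains[OF assms(2) that]
      chain_complex_shifted_chains[OF simplicial_complex_complete_hypergraph that]
    by (auto simp: sub_chain_complex_def shifted_chains_def dest: chains_mono)
  then show ?thesis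
    using chain_map_Ext[OF assms(2), of _ V t _ s m] by (simp add: ext)
qed

end
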